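(* Let $G$ be a finite group. Then the power graph $\mathcal{P}(G)$ is claw-free (that is, has no induced subgraph isomorphic to $K_{1,3}$) if and only if $G$ is a cyclic group of order $p^m q^n$ for some distinct primes $p,q$ and some non-negative integers $m,n$ with $\{m,n\}\cap\{0,1\}\neq\emptyset$.
   Context: The power graph $\mathcal{P}(G)$ of a finite group $G$ is the simple graph with vertex set $G$ in which two distinct elements $x,y$ are adjacent if and only if $x\in\langle y\rangle$ or $y\in\langle x\rangle$. A graph is $\Gamma$-free if it has no induced subgraph isomorphic to $\Gamma$; claw-free means $K_{1,3}$-free. *)

theory Defs
  imports "HOL-Algebra.Algebra" "Graph_Theory.Graph_Theory"
begin

text \<open>
  As everywhere in the Graph_Theory library, a simple graph is a loop-free symmetric digraph
  without parallel arcs: the edge between \<open>x\<close> and \<open>y\<close> is the pair of arcs \<open>(x, y)\<close>, \<open>(y, x)\<close>.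
\<close>

definition power_graph :: "('a, 'm) monoid_scheme \<Rightarrow> 'a pair_pre_digraph" where
  "power_graph G = \<lparr>
     pverts = carrier G,
     parcs = {(x, y). x \<in> carrier G \<and> y \<in> carrier G \<and> x \<noteq> y \<and>
       (x \<in> generate G {y} \<or> y \<in> generate G {x})} \<rparr>"

lemma (in group) pair_graph_power_graph:
  assumes "finite (carrier G)"
  shows "pair_graph (power_graph G)"
proof
  have "parcs (power_graph G) \<subseteq> carrier G \<times> carrier G"
    by (auto simp: power_graph_def)
  then show "finite (parcs (power_graph G))"
    using assms finite_subset by blast
qed (auto simp: power_graph_def symmetric_def assms intro!: symI)

definition induced_free :: "('c, 'd) pre_digraph \<Rightarrow> ('a, 'b) pre_digraph \<Rightarrow> bool" where
  "induced_free \<Gamma> G \<longleftrightarrow> \<not> (\<exists>H. induced_subgraph H G \<and> digraph_iso H \<Gamma>)"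

definition claw :: "nat pair_pre_digraph" where
  "claw = \<lparr> pverts = {0, 1, 2, 3}, parcs = {0} \<times> {1, 2, 3} \<union> {1, 2, 3} \<times> {0} \<rparr>"

lemma complete_bipartite_claw: "K\<^bsub>1,3\<^esub> (with_proj claw)"
  unfolding complete_bipartite_digraph_pair_def
proof (intro conjI exI)
  show "pverts claw = {0} \<union> {1, 2, 3}" "parcs claw = {0} \<times> {1, 2, 3} \<union> {1, 2, 3} \<times> {0}"
    by (auto simp: claw_def)
qed (simp_all add: claw_def)

definition claw_free :: "('a, 'b) pre_digraph \<Rightarrow> bool" where
  "claw_free G \<longleftrightarrow> induced_free (with_proj claw) G"

end

theory Submission
  imports Defs
begin

text \<open>
  The identity is adjacent to every other vertex, so the power graph contains an induced claw iff
  it contains three pairwise non-adjacent vertices, that is, a 3-antichain of the preorder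
  \<open>x \<in> \<langle>y\<rangle>\<close>. In a non-cyclic group, generators of three distinct maximal cyclic subgroups form
  one. In a cyclic group the preorder is divisibility of element orders, which reduces the claim
  to antichains of divisors of \<open>N = order G\<close>: three prime divisors \<open>p, q, r\<close>, or \<open>p\<^sup>2, p q, q\<^sup>2\<close>, are
  antichains, whereas the divisors of \<open>p\<^sup>m q\<close> are covered by the two chains \<open>p\<^sup>i\<close> and \<open>p\<^sup>i q\<close>.
\<close>

section \<open>Induced claws in a graph with a dominating vertex\<close>

text \<open>The relation is a parameter: it will be adjacency or equality, membership in a cyclic
  subgroup, and divisibility. All three are reflexive, so the conditions force \<open>x\<close>,
  \<open>y\<close>, \<open>z\<close> to be distinct.\<close>

definition has_antichain3 :: "('a \<Rightarrow> 'a \<Rightarrow> bool) \<Rightarrow> 'a set \<Rightarrow> bool" where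
  "has_antichain3 r A \<longleftrightarrow> (\<exists>x\<in>A. \<exists>y\<in>A. \<exists>z\<in>A.
     \<not> r x y \<and> \<not> r y x \<and> \<not> r x z \<and> \<not> r z x \<and> \<not> r y z \<and> \<not> r z y)"

text \<open>The dominating vertex \<open>c\<close> is the centre over any three pairwise
  non-adjacent vertices; conversely, the leaves of an induced claw are such a triple.\<close>

lemma claw_free_dominated_iff:
  assumes "pair_graph P" and c: "c \<in> pverts P"
    and dom: "\<And>v. v \<in> pverts P \<Longrightarrow> v \<noteq> c \<Longrightarrow> (c, v) \<in> parcs P"
  shows "claw_free (with_proj P) \<longleftrightarrow>
    \<not> has_antichain3 (\<lambda>x y. x = y \<or> (x, y) \<in> parcs P) (pverts P)"
proof -
  interpret pair_graph P by fact
  have sym: "(u, v) \<in> parcs P \<Longrightarrow> (v, u) \<in> parcs P" for u v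
    using sym_arcs by (simp add: symmetric_def symD)
  show ?thesis
  proof
    assume free: "claw_free (with_proj P)"
    show "\<not> has_antichain3 (\<lambda>x y. x = y \<or> (x, y) \<in> parcs P) (pverts P)"
    proof
      assume "has_antichain3 (\<lambda>x y. x = y \<or> (x, y) \<in> parcs P) (pverts P)"
      then obtain x y z where
        V: "x \<in> pverts P" "y \<in> pverts P" "z \<in> pverts P" and
        neq: "x \<noteq> y" "x \<noteq> z" "y \<noteq> z" and
        nadj: "(x, y) \<notin> parcs P" "(y, x) \<notin> parcs P" "(x, z) \<notin> parcs P"
          "(z, x) \<notin> parcs P" "(y, z) \<notin> parcs P" "(z, y) \<notin> parcs P"
        unfolding has_antichain3_def by blast
      have c_neq: "x \<noteq> c" "y \<noteq> c" "z \<noteq> c"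
        using V neq nadj dom by metis+
      have adj: "(c, x) \<in> parcs P" "(c, y) \<in> parcs P" "(c, z) \<in> parcs P"
        using V c_neq dom by auto
      \<comment> \<open>The induced subgraph on \<open>c\<close>, \<open>x\<close>,
        \<open>y\<close>, \<open>z\<close>, with its arcs spelled out in the shape of
        \<open>claw\<close>; \<open>arcs_Q\<close> confirms that it is induced.\<close>
      define Q where
        "Q = \<lparr> pverts = {c, x, y, z}, parcs = {c} \<times> {x, y, z} \<union> {x, y, z} \<times> {c} \<rparr>"
      define f where
        "f v = (if v = c then 0 else if v = x then 1 else if v = y then 2 else 3 :: nat)" for v
      have "pair_wf_digraph Q"
        by unfold_locales (auto simp: Q_def)
      then have wf: "wf_digraph (with_proj Q)"
        by (simp add: wf_digraph_wp_iff)
      have arcs_Q: "parcs Q = {e \<in> parcs P. fst e \<in> pverts Q \<and> snd e \<in> pverts Q}"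
      proof (intro equalityI subsetI)
        fix e assume "e \<in> parcs Q"
        then show "e \<in> {e \<in> parcs P. fst e \<in> pverts Q \<and> snd e \<in> pverts Q}"
          using adj adj[THEN sym] by (auto simp: Q_def)
      next
        fix e assume "e \<in> {e \<in> parcs P. fst e \<in> pverts Q \<and> snd e \<in> pverts Q}"
        then obtain u v where e: "e = (u, v)" "(u, v) \<in> parcs P" "u \<noteq> v"
          and uv: "u \<in> {c, x, y, z}" "v \<in> {c, x, y, z}"
          using no_loops[of e] by (cases e) (auto simp: Q_def)
        then have "u = c \<or> v = c"
          using nadj by blast
        with e uv show "e \<in> parcs Q"
          by (auto simp: Q_def)
      qed
      have "induced_subgraph (with_proj Q) (with_proj P)"
        unfolding induced_subgraph_def subgraph_def compatible_def
        using V c arcs_Q wf wf_digraph by (auto simp: Q_def)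
      moreover have "digraph_iso (with_proj Q) (with_proj claw)"
      proof -
        let ?h = "\<lparr> iso_verts = f, iso_arcs = map_prod f f, iso_head = snd, iso_tail = fst \<rparr>"
        have inj: "inj_on f {c, x, y, z}"
          using neq c_neq by (auto simp: inj_on_def f_def)
        then have "inj_on (map_prod f f) (parcs Q)"
          by (intro inj_on_subset[OF map_prod_inj_on[OF inj inj]]) (auto simp: Q_def)
        then have "pre_digraph.digraph_isomorphism (with_proj Q) ?h"
          using inj wf by (simp add: pre_digraph.digraph_isomorphism_def Q_def)
        moreover have "with_proj claw = app_iso ?h (with_proj Q)"
          using neq c_neq
          by (simp add: app_iso_def with_proj_def claw_def Q_def f_def image_Un insert_Times_insert insert_commute)
        ultimately show ?thesis
          unfolding digraph_iso_def by blast
      qed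
      ultimately show False
        using free by (auto simp: claw_free_def induced_free_def)
    qed
  next
    assume no: "\<not> has_antichain3 (\<lambda>x y. x = y \<or> (x, y) \<in> parcs P) (pverts P)"
    show "claw_free (with_proj P)"
      unfolding claw_free_def induced_free_def
    proof
      assume "\<exists>H. induced_subgraph H (with_proj P) \<and> digraph_iso H (with_proj claw)"
      then obtain H h where ind: "induced_subgraph H (with_proj P)"
        and iso: "pre_digraph.digraph_isomorphism H h" and app: "with_proj claw = app_iso h H"
        unfolding digraph_iso_def by blast
      have sub: "verts H \<subseteq> pverts P"
        and arcs: "arcs H = {e \<in> parcs P. fst e \<in> verts H \<and> snd e \<in> verts H}"
        and "tail H = fst" "head H = snd"
        using ind by (auto simp: induced_subgraph_def subgraph_def compatible_def)
      have V: "iso_verts h ` verts H = {0, 1, 2, 3}"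
        and A: "iso_arcs h ` arcs H = parcs claw" and "iso_tail h = fst" "iso_head h = snd"
        using app by (auto simp: app_iso_def with_proj_def claw_def)
      \<comment> \<open>Since \<open>H\<close> is induced, an edge of \<open>P\<close> between two
        of its vertices is sent to an edge of the claw. So vertices sent to leaves are non-adjacent
        in \<open>P\<close>.\<close>
      have pres: "(iso_verts h u, iso_verts h v) \<in> parcs claw"
        if "u \<in> verts H" "v \<in> verts H" "(u, v) \<in> parcs P" for u v
      proof -
        have "(u, v) \<in> arcs H"
          using that arcs by simp
        moreover from this have "iso_arcs h (u, v) = (iso_verts h u, iso_verts h v)"
          using iso \<open>tail H = fst\<close> \<open>head H = snd\<close> \<open>iso_tail h = fst\<close> \<open>iso_head h = snd\<close>
          by (auto simp: pre_digraph.digraph_isomorphism_def prod_eq_iff)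
        ultimately show ?thesis
          using A by (metis imageI)
      qed
      have "\<exists>v\<in>verts H. iso_verts h v = k" if "k \<in> {0, 1, 2, 3}" for k
        using that V by (metis imageE)
      then obtain x y z where xyz: "x \<in> verts H" "y \<in> verts H" "z \<in> verts H"
        "iso_verts h x = 1" "iso_verts h y = 2" "iso_verts h z = 3"
        by (meson insertCI)
      have "x \<noteq> y" "x \<noteq> z" "y \<noteq> z"
        using xyz by auto
      moreover have "(x, y) \<notin> parcs P" "(x, z) \<notin> parcs P" "(y, z) \<notin> parcs P"
        using pres[of x y] pres[of x z] pres[of y z] xyz by (auto simp: claw_def)
      moreover from this have "(y, x) \<notin> parcs P" "(z, x) \<notin> parcs P" "(z, y) \<notin> parcs P"
        using sym by metis+
      moreover have "x \<in> pverts P" "y \<in> pverts P" "z \<in> pverts P"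
        using xyz sub by auto
      ultimately have "has_antichain3 (\<lambda>x y. x = y \<or> (x, y) \<in> parcs P) (pverts P)"
        unfolding has_antichain3_def by metis
      with no show False
        by blast
    qed
  qed
qed

section \<open>Antichains of cyclic subgroups\<close>

context group
begin

lemma generate_singleton_mono:
  assumes "x \<in> generate G {y}" "y \<in> carrier G"
  shows "generate G {x} \<subseteq> generate G {y}"
  using assms by (intro generate_subgroup_incl generate_is_subgroup) auto

text \<open>The identity lies in every cyclic subgroup and hence dominates. Adjacency or equality is
  the symmetric closure of \<open>x \<in> generate G {y}\<close>, and \<open>has_antichain3\<close>
  tests each pair in both directions, so both relations have the same antichains.\<close>

lemma claw_free_power_graph_iff:
  assumes "finite (carrier G)"
  shows "claw_free (with_proj (power_graph G)) \<longleftrightarrow>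
    \<not> has_antichain3 (\<lambda>x y. x \<in> generate G {y}) (carrier G)"
proof -
  have "claw_free (with_proj (power_graph G)) \<longleftrightarrow> \<not> has_antichain3
    (\<lambda>x y. x = y \<or> (x, y) \<in> parcs (power_graph G)) (pverts (power_graph G))"
    by (rule claw_free_dominated_iff[OF pair_graph_power_graph[OF assms], of \<one>])
      (auto simp: power_graph_def intro: generate.one)
  also have "\<dots> \<longleftrightarrow> \<not> has_antichain3 (\<lambda>x y. x \<in> generate G {y}) (carrier G)"
  proof -
    have "x \<in> generate G {x}" for x
      by (simp add: generate.incl)
    then have "x = y \<or> (x, y) \<in> parcs (power_graph G) \<longleftrightarrow> x \<in> generate G {y} \<or> y \<in> generate G {x}"
      if "x \<in> carrier G" "y \<in> carrier G" for x y
      using that by (auto simp: power_graph_def)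
    moreover have "pverts (power_graph G) = carrier G"
      by (simp add: power_graph_def)
    ultimately show ?thesis
      unfolding has_antichain3_def by (simp cong: bex_cong) blast
  qed
  finally show ?thesis .
qed

text \<open>Among the cyclic subgroups containing \<open>x\<close>, one of greatest cardinality is
  maximal under inclusion. Maximality is stated for generators, the form in which it excludes
  comparabilities.\<close>

lemma ex_maximal_cyclic:
  assumes "finite (carrier G)" "x \<in> carrier G"
  obtains y where "y \<in> carrier G" "x \<in> generate G {y}"
    "\<And>z. z \<in> carrier G \<Longrightarrow> y \<in> generate G {z} \<Longrightarrow> z \<in> generate G {y}"
proof -
  let ?Y = "{y \<in> carrier G. x \<in> generate G {y}}"
  have "\<exists>y. y \<in> ?Y \<and> (\<forall>z. z \<in> ?Y \<longrightarrow> card (generate G {z}) \<le> card (generate G {y}))"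
  proof (rule ex_has_greatest_nat)
    show "x \<in> ?Y"
      using assms by (simp add: generate.incl)
    show "\<forall>y. y \<in> ?Y \<longrightarrow> card (generate G {y}) < Suc (card (carrier G))"
      using assms by (simp add: card_mono generate_incl less_Suc_eq_le)
  qed
  then obtain y where y: "y \<in> ?Y"
    and max: "\<And>z. z \<in> ?Y \<Longrightarrow> card (generate G {z}) \<le> card (generate G {y})"
    by blast
  show thesis
  proof
    show "y \<in> carrier G" "x \<in> generate G {y}"
      using y by auto
    fix z assume z: "z \<in> carrier G" "y \<in> generate G {z}"
    have "generate G {y} \<subseteq> generate G {z}"
      using z(2,1) by (rule generate_singleton_mono)
    moreover have "finite (generate G {z})"
      using assms z generate_incl[of "{z}"] finite_subset by auto
    ultimately have "generate G {y} = generate G {z}"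
      using max[of z] y z by (intro card_seteq) auto
    then show "z \<in> generate G {y}"
      by (simp add: generate.incl)
  qed
qed

text \<open>
  A group is not the union of two proper subgroups, so a non-cyclic one has at least three
  maximal cyclic subgroups.
\<close>

lemma not_cyclic_imp_antichain3:
  assumes fin: "finite (carrier G)" and "\<not> cyclic_group G"
  shows "has_antichain3 (\<lambda>x y. x \<in> generate G {y}) (carrier G)"
proof -
  have sg: "subgroup (generate G {x}) G" if "x \<in> carrier G" for x
    using that by (intro generate_is_subgroup) auto
  have trans: "x \<in> generate G {z}"
    if "x \<in> generate G {y}" "y \<in> generate G {z}" "z \<in> carrier G" for x y z
    using that generate_singleton_mono by blast
  have proper: "\<exists>b\<in>carrier G. b \<notin> generate G {a}" if "a \<in> carrier G" for a
  proof (rule ccontr)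
    assume "\<not> ?thesis"
    then have "carrier G = generate G {a}"
      using that generate_incl[of "{a}"] by blast
    then have "cyclic_group G"
      using that generate_pow[OF that] unfolding cyclic_group by blast
    with assms show False
      by blast
  qed
  \<comment> \<open>The identity lies in every cyclic subgroup, so this picks an arbitrary maximal
    one.\<close>
  obtain a where a: "a \<in> carrier G"
    and amax: "\<And>z. z \<in> carrier G \<Longrightarrow> a \<in> generate G {z} \<Longrightarrow> z \<in> generate G {a}"
    using ex_maximal_cyclic[OF fin one_closed] by metis
  obtain b' where b': "b' \<in> carrier G" "b' \<notin> generate G {a}"
    using proper[OF a] by blast
  obtain b where b: "b \<in> carrier G" "b' \<in> generate G {b}"
    and bmax: "\<And>z. z \<in> carrier G \<Longrightarrow> b \<in> generate G {z} \<Longrightarrow> z \<in> generate G {b}"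
    using ex_maximal_cyclic[OF fin b'(1)] by metis
  have ba: "b \<notin> generate G {a}"
    using trans a b b' by blast
  then have ab: "a \<notin> generate G {b}"
    using amax b by blast
  \<comment> \<open>The product lies in neither subgroup, since cancelling one factor would put the
    other into the same subgroup; \<open>c\<close> will generate a maximal cyclic subgroup
    containing it.\<close>
  let ?c = "a \<otimes> b"
  have "?c \<in> carrier G"
    using a b by simp
  then obtain c where c: "c \<in> carrier G" "?c \<in> generate G {c}"
    and cmax: "\<And>z. z \<in> carrier G \<Longrightarrow> c \<in> generate G {z} \<Longrightarrow> z \<in> generate G {c}"
    using ex_maximal_cyclic[OF fin] by metis
  have "?c \<notin> generate G {a}"
  proof
    assume "?c \<in> generate G {a}"
    then have "inv a \<otimes> ?c \<in> generate G {a}"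
      using subgroup.m_closed[OF sg[OF a] generate.inv] by blast
    then show False
      using a b ba by (simp flip: m_assoc)
  qed
  then have ca: "c \<notin> generate G {a}"
    using trans c a by blast
  have "?c \<notin> generate G {b}"
  proof
    assume "?c \<in> generate G {b}"
    then have "?c \<otimes> inv b \<in> generate G {b}"
      using subgroup.m_closed[OF sg[OF b(1)] _ generate.inv] by blast
    then show False
      using a b ab by (simp add: m_assoc)
  qed
  then have cb: "c \<notin> generate G {b}"
    using trans c b by blast
  \<comment> \<open>By maximality, \<open>a\<close> or \<open>b\<close> in the subgroup of
    \<open>c\<close> would put \<open>c\<close> into that of \<open>a\<close> or \<open>b\<close>,
    which \<open>ca\<close> and \<open>cb\<close> exclude.\<close>
  show ?thesis
    unfolding has_antichain3_def using a b c ab ba ca cb amax bmax by blast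
qed

section \<open>Element orders in cyclic groups\<close>

lemma ord_dvd_if_mem_generate:
  assumes "x \<in> generate G {y}" "y \<in> carrier G"
  shows "ord x dvd ord y"
proof -
  obtain k :: int where "x = y [^] k"
    using assms generate_pow by blast
  then have "x [^] ord y = \<one>"
    using assms by (metis int_pow_int int_pow_pow int_pow_one mult.commute pow_ord_eq_1)
  then show ?thesis
    using assms generate_incl[of "{y}"] by (subst pow_eq_id[symmetric]) auto
qed

lemma cyclic_obtain_generator:
  assumes "cyclic_group G"
  obtains g where "g \<in> carrier G" "generate G {g} = carrier G" "ord g = order G"
proof -
  obtain g where g: "g \<in> carrier G" "carrier G = range (\<lambda>n::int. g [^] n)"
    using assms cyclic_group by blast
  then have "generate G {g} = carrier G"
    using generate_pow by auto
  with g show thesis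
    using generate_pow_card[of g] that by (simp add: order_def)
qed

text \<open>The power of a generator whose exponent is the cofactor of \<open>d\<close> has order
  \<open>d\<close>. Thus the orders of elements exhaust the divisors of
  \<open>order G\<close>.\<close>

lemma cyclic_obtain_ord:
  assumes "finite (carrier G)" "cyclic_group G" "d dvd order G"
  obtains x where "x \<in> carrier G" "ord x = d"
proof -
  obtain g where g: "g \<in> carrier G" "ord g = order G"
    using assms cyclic_obtain_generator by metis
  obtain k where k: "order G = d * k"
    using assms by blast
  have "order G > 0"
    using assms by (simp add: order_gt_0_iff_finite)
  then have "ord (g [^] k) = d"
    using g k by (simp add: ord_pow)
  with g that show thesis
    by blast
qed

text \<open>
  Both \<open>x\<close> and \<open>y\<close> lie in the subgroup of the \<open>k\<close>-th powers of a generator, where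
  \<open>k\<close> is the index of \<open>\<langle>y\<rangle>\<close>; by cardinality this subgroup is \<open>\<langle>y\<rangle>\<close>.
\<close>

lemma cyclic_mem_generate_iff_ord_dvd:
  assumes fin: "finite (carrier G)" and "cyclic_group G"
    and x: "x \<in> carrier G" and y: "y \<in> carrier G"
  shows "x \<in> generate G {y} \<longleftrightarrow> ord x dvd ord y"
proof
  assume dvd: "ord x dvd ord y"
  obtain g where g: "g \<in> carrier G" "generate G {g} = carrier G" "ord g = order G"
    using assms cyclic_obtain_generator by metis
  obtain k where k: "order G = ord y * k"
    using ord_dvd_group_order[OF y] by blast
  have pos: "order G > 0"
    using fin by (simp add: order_gt_0_iff_finite)
  let ?h = "g [^] k"
  have h: "?h \<in> carrier G"
    using g by simp
  have ord_h: "ord ?h = ord y"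
    using g k pos by (simp add: ord_pow)
  have mem: "z \<in> generate G {?h}" if z: "z \<in> carrier G" "ord z dvd ord y" for z
  proof -
    obtain i :: nat where i: "z = g [^] i"
      using z g generate_pow_on_finite_carrier[OF fin g(1)] by blast
    have "z [^] ord y = \<one>"
      using z by (simp add: pow_eq_id)
    then have "order G dvd i * ord y"
      using g by (simp add: i nat_pow_pow pow_eq_id)
    \<comment> \<open>Here \<open>order G = ord y * k\<close>, so the positive factor
      \<open>ord y\<close> cancels.\<close>
    then have "k dvd i"
      using pos k by (simp add: mult.commute)
    then obtain j where "i = k * j"
      by blast
    then have "z = ?h [^] j"
      using g i by (simp add: nat_pow_pow)
    then show ?thesis
      using generate_pow_on_finite_carrier[OF fin h] by blast
  qed
  have "generate G {y} = generate G {?h}"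
  proof (rule card_subset_eq)
    show "finite (generate G {?h})"
      using h fin generate_incl[of "{?h}"] finite_subset by auto
    show "generate G {y} \<subseteq> generate G {?h}"
      using mem[OF y] h by (intro generate_singleton_mono) auto
    show "card (generate G {y}) = card (generate G {?h})"
      using ord_h h y by (simp flip: generate_pow_card)
  qed
  then show "x \<in> generate G {y}"
    using mem[OF x dvd] by simp
qed (use y ord_dvd_if_mem_generate in blast)

text \<open>\<open>ord\<close> maps the carrier onto the divisors of \<open>order G\<close> and both
  preserves and reflects the preorder, so antichains transfer in both directions.\<close>

lemma cyclic_antichain3_iff:
  assumes "finite (carrier G)" "cyclic_group G"
  shows "has_antichain3 (\<lambda>x y. x \<in> generate G {y}) (carrier G) \<longleftrightarrow>
    has_antichain3 (dvd) {d. d dvd order G}"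
proof -
  have "{d. d dvd order G} = ord ` carrier G"
    using ord_dvd_group_order by (auto elim: cyclic_obtain_ord[OF assms])
  then show ?thesis
    by (simp add: has_antichain3_def cyclic_mem_generate_iff_ord_dvd[OF assms])
qed

end

section \<open>Antichains of divisors\<close>

lemma divisors_antichain3_iff:
  fixes N :: nat
  assumes "N > 0"
  shows "\<not> has_antichain3 (dvd) {d. d dvd N} \<longleftrightarrow>
    (\<exists>p q m n :: nat. Factorial_Ring.prime p \<and> Factorial_Ring.prime q \<and> p \<noteq> q \<and>
       N = p ^ m * q ^ n \<and> {m, n} \<inter> {0, 1} \<noteq> {})"
proof
  assume no: "\<not> has_antichain3 (dvd) {d. d dvd N}"
  have "\<exists>p q. Factorial_Ring.prime p \<and> Factorial_Ring.prime q \<and> p \<noteq> q \<and> prime_factors N \<subseteq> {p, q}"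
  proof (rule ccontr)
    assume contr: "\<not> ?thesis"
    then have ex: "\<exists>r\<in>prime_factors N. r \<noteq> p \<and> r \<noteq> q"
      if "Factorial_Ring.prime p" "Factorial_Ring.prime q" "p \<noteq> q" for p q
      using that by blast
    \<comment> \<open>\<open>ex\<close> asks for two distinct primes, so 2 and 3 start the search
      and 2 fills the second place until two prime factors are known.\<close>
    obtain p where p: "p \<in> prime_factors N" "p \<noteq> 2"
      using ex[OF two_is_prime_nat _, of 3] by auto
    then obtain q where q: "q \<in> prime_factors N" "q \<noteq> p"
      using ex[of p 2] two_is_prime_nat by auto
    then obtain r where r: "r \<in> prime_factors N" "r \<noteq> p" "r \<noteq> q"
      using ex[of p q] p by auto
    have "\<not> u dvd v" if "u \<in> prime_factors N" "v \<in> prime_factors N" "u \<noteq> v" for u v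
      using that primes_dvd_imp_eq[of u v] by auto
    then have "has_antichain3 (dvd) {d. d dvd N}"
      unfolding has_antichain3_def using p q r
      by (intro bexI[of _ p] bexI[of _ q] bexI[of _ r]) auto
    with no show False
      by blast
  qed
  then obtain p q where pq: "Factorial_Ring.prime p" "Factorial_Ring.prime q" "p \<noteq> q"
    and sub: "prime_factors N \<subseteq> {p, q}"
    by blast
  let ?m = "multiplicity p N" and ?n = "multiplicity q N"
  have "N = (\<Prod>r\<in>prime_factors N. r ^ multiplicity r N)"
    using assms by (simp add: prime_factorization_nat)
  \<comment> \<open>A prime among \<open>p\<close>, \<open>q\<close> that does not divide
    \<open>N\<close> has multiplicity 0 and contributes the factor 1.\<close>
  also have "\<dots> = (\<Prod>r\<in>{p, q}. r ^ multiplicity r N)"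
    using sub pq by (intro prod.mono_neutral_left) (auto simp: prime_factors_multiplicity)
  finally have N: "N = p ^ ?m * q ^ ?n"
    using pq by simp
  have "{?m, ?n} \<inter> {0, 1} \<noteq> {}"
  proof (rule ccontr)
    assume "\<not> ?thesis"
    then have "2 \<le> ?m" "2 \<le> ?n"
      by auto
    then have dvds: "p\<^sup>2 dvd p ^ ?m" "q\<^sup>2 dvd q ^ ?n" "p dvd p ^ ?m" "q dvd q ^ ?n"
      by (auto intro: le_imp_power_dvd)
    have "p\<^sup>2 dvd N" "q\<^sup>2 dvd N" "p * q dvd N"
      by (subst N; use dvds in \<open>auto intro: dvd_mult dvd_mult2 mult_dvd_mono\<close>)+
    moreover have npq: "\<not> p dvd q" "\<not> q dvd p"
      using pq primes_dvd_imp_eq by blast+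
    then have "\<not> p dvd q\<^sup>2" "\<not> q dvd p\<^sup>2"
      using pq prime_dvd_power by blast+
    moreover have "\<not> p\<^sup>2 dvd p * q" "\<not> q\<^sup>2 dvd p * q"
      using npq pq by (auto simp: power2_eq_square prime_gt_0_nat)
    \<comment> \<open>The other comparisons reduce to these: \<open>p * q\<close> dividing
      \<open>p\<^sup>2\<close> gives \<open>q\<close> dividing \<open>p\<^sup>2\<close>, and
      \<open>p\<^sup>2\<close> dividing \<open>q\<^sup>2\<close> gives \<open>p\<close> dividing
      \<open>q\<^sup>2\<close>.\<close>
    ultimately have "has_antichain3 (dvd) {d. d dvd N}"
      unfolding has_antichain3_def
      by (intro bexI[of _ "p\<^sup>2"] bexI[of _ "q\<^sup>2"] bexI[of _ "p * q"])
        (auto dest: dvd_mult_left dvd_mult_right simp: power2_eq_square)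
    with no show False
      by blast
  qed
  with pq N show "\<exists>p q m n :: nat. Factorial_Ring.prime p \<and> Factorial_Ring.prime q \<and> p \<noteq> q \<and>
       N = p ^ m * q ^ n \<and> {m, n} \<inter> {0, 1} \<noteq> {}"
    by blast
next
  \<comment> \<open>Primes and exponents are variables here, so that the case
    \<open>m \<le> 1\<close> follows by exchanging \<open>p\<close> and \<open>q\<close>.\<close>
  have main: False if p: "Factorial_Ring.prime p" and q: "Factorial_Ring.prime q"
    and N: "N = p ^ m * q ^ n" and n: "n \<le> 1"
    and anti: "has_antichain3 (dvd) {d. d dvd N}" for p q m n :: nat
  proof -
    have form: "\<exists>i. d = p ^ i \<or> d = p ^ i * q" if "d dvd N" for d
    proof -
      obtain a b where "d = a * b" "a dvd p ^ m" "b dvd q ^ n"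
        using \<open>d dvd N\<close> N division_decomp by blast
      moreover then obtain i j where "a = p ^ i" "b = q ^ j" "j \<le> n"
        using p q by (auto simp: divides_primepow_nat)
      moreover have "j = 0 \<or> j = 1"
        using \<open>j \<le> n\<close> n by linarith
      ultimately show ?thesis
        by auto
    qed
    have comp: "p ^ i dvd p ^ j \<or> p ^ j dvd p ^ i" for i j
      using le_imp_power_dvd nat_le_linear by metis
    then have comp': "p ^ i * q dvd p ^ j * q \<or> p ^ j * q dvd p ^ i * q" for i j
      by (meson dvd_refl mult_dvd_mono)
    obtain x y z where "x dvd N" "y dvd N" "z dvd N"
      and "\<not> x dvd y" "\<not> y dvd x" "\<not> x dvd z" "\<not> z dvd x" "\<not> y dvd z" "\<not> z dvd y"
      using anti unfolding has_antichain3_def by blast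
    \<comment> \<open>Two of the three divisors lie in the same chain, \<open>p ^ i\<close> or
      \<open>p ^ i * q\<close>, and are therefore comparable.\<close>
    then show False
      using form[of x] form[of y] form[of z] comp comp' by metis
  qed
  assume "\<exists>p q m n :: nat. Factorial_Ring.prime p \<and> Factorial_Ring.prime q \<and> p \<noteq> q \<and>
       N = p ^ m * q ^ n \<and> {m, n} \<inter> {0, 1} \<noteq> {}"
  then obtain p q m n :: nat where "Factorial_Ring.prime p" "Factorial_Ring.prime q"
    "N = p ^ m * q ^ n" "{m, n} \<inter> {0, 1} \<noteq> {}"
    by blast
  moreover from this have "n \<le> 1 \<or> m \<le> 1"
    by auto
  ultimately show "\<not> has_antichain3 (dvd) {d. d dvd N}"
    using main[of p q m n] main[of q p n m] by (auto simp: mult.commute)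
qed

theorem theorem2p2:
  fixes G :: "('a, 'm) monoid_scheme"
  assumes "group G" and "finite (carrier G)"
  shows "claw_free (with_proj (power_graph G)) \<longleftrightarrow>
    cyclic_group G \<and>
    (\<exists>p q m n :: nat. Factorial_Ring.prime p \<and> Factorial_Ring.prime q \<and> p \<noteq> q \<and>
       order G = p ^ m * q ^ n \<and> {m, n} \<inter> {0, 1} \<noteq> {})"
proof -
  interpret group G by fact
  have "order G > 0"
    using assms by (simp add: order_gt_0_iff_finite)
  then show ?thesis
    using claw_free_power_graph_iff[OF assms(2)] not_cyclic_imp_antichain3[OF assms(2)]
      cyclic_antichain3_iff[OF assms(2)] divisors_antichain3_iff[of "order G"]
    by blast
qed

end
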